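(* Let $n,m\ge1$ and let $f=(f_1,\dots,f_m)\colon\mathbb{R}^n\to\mathbb{R}^m$ with each $f_j$ continuously differentiable with Lipschitz continuous gradient on $\mathbb{R}^n$, and assume that $\min_{x\in\mathbb{R}^n}f(x)$ has at least one weakly efficient point. Let $x^k\in\mathbb{R}^n$ be a point which is not Pareto critical, that is, $\omega(x^k)>0$. Let $\lambda^k$ be an optimal solution of $(\Omega(x^k))$ (see context), and put $g_k^s:=\sum_{j=1}^m\lambda_j^k\nabla f_j(x^k)$ and $n_k^s:=-\frac{1}{\|g_k^s\|_2}g_k^s$. Then: (a) $n_k^s$ is an optimal solution of $$\min_{\|d\|_2^2\le 1}\ \max_{j\in\{1,\dots,m\}}\nabla f_j(x^k)^\top d.$$ (b) $-g_k^s$ is the unique optimal solution of $\min_{d\in\mathbb{R}^n}h(d)$, where $$h(d):=\Big(\max_{j\in\{1,\dots,m\}}\nabla f_j(x^k)^\top d\Big)+\frac12\|d\|_2^2,$$ and the optimal value $h(-g_k^s)$ satisfies $\omega(x^k)=\|g_k^s\|_2^2=-2h(-g_k^s)$. (c) The direction $n_k^s$, and thus also $-g_k^s$, is a common descent direction of $f$ at $x^k$; i.e., for $v=n_k^s$ (and likewise for $v=-g_k^s$) there exists $t_0>0$ such that $f_j(x^k+t'v)<f_j(x^k)$ for all $j\in\{1,\dots,m\}$ and all $t'\in(0,t_0]$.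
   Context: A point $\bar x\in\mathbb{R}^n$ is weakly efficient if there is no $x\in\mathbb{R}^n$ with $f_j(x)<f_j(\bar x)$ for all $j\in\{1,\dots,m\}$. A point $x\in\mathbb{R}^n$ is Pareto critical if there are $\lambda_j\ge0$, $j=1,\dots,m$, with $\sum_{j=1}^m\lambda_j=1$ and $\sum_{j=1}^m\lambda_j\nabla f_j(x)=0$. For $x\in\mathbb{R}^n$, $\omega(x)$ denotes the optimal value of $$\min_{\lambda\in\mathbb{R}^m}\Big\|\sum_{j=1}^m\lambda_j\nabla f_j(x)\Big\|_2^2\quad\text{s.t. }\sum_{j=1}^m\lambda_j=1,\ \lambda\ge 0.\qquad(\Omega(x))$$ A point $x$ is Pareto critical if and only if $\omega(x)=0$. *)

theory Defs
  imports "HOL-Analysis.Analysis"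
begin

definition grad :: "('a::real_inner \<Rightarrow> real) \<Rightarrow> 'a \<Rightarrow> 'a" where
  "grad \<phi> x = (THE D. GDERIV \<phi> x :> D)"

lemma grad_eqI:
  assumes "GDERIV \<phi> x :> D"
  shows "grad \<phi> x = D"
  unfolding grad_def
proof (rule the_equality)
  show "GDERIV \<phi> x :> D" by (fact assms)
next
  fix E assume "GDERIV \<phi> x :> E"
  with assms have "(\<lambda>h. h \<bullet> E) = (\<lambda>h. h \<bullet> D)"
    unfolding gderiv_def by (rule has_derivative_unique[rotated])
  then have "h \<bullet> (E - D) = 0" for h
    by (metis inner_diff_right right_minus_eq)
  then show "E = D"
    by (metis inner_eq_zero_iff right_minus_eq)
qed

lemma GDERIV_grad:
  fixes \<phi> :: "'a::euclidean_space \<Rightarrow> real"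
  assumes "\<phi> differentiable (at x)"
  shows "GDERIV \<phi> x :> grad \<phi> x"
proof -
  obtain \<phi>' where d: "(\<phi> has_derivative \<phi>') (at x)"
    using assms by (auto simp: differentiable_def)
  then have "linear \<phi>'"
    by (rule has_derivative_linear)
  then have "\<phi>' = (\<lambda>h. h \<bullet> adjoint \<phi>' 1)"
    by (simp add: adjoint_works fun_eq_iff)
  with d have "GDERIV \<phi> x :> adjoint \<phi>' 1"
    by (simp add: gderiv_def)
  then show ?thesis
    by (metis grad_eqI)
qed

definition C1_lipschitz_grad :: "('a::euclidean_space \<Rightarrow> real) \<Rightarrow> bool" where
  "C1_lipschitz_grad \<phi> \<longleftrightarrow>
     (\<forall>x. \<phi> differentiable (at x)) \<and> continuous_on UNIV (grad \<phi>) \<and>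
     (\<exists>L. L-lipschitz_on UNIV (grad \<phi>))"

definition weakly_efficient :: "(real^'n \<Rightarrow> real^'m) \<Rightarrow> real^'n \<Rightarrow> bool" where
  "weakly_efficient f xb \<longleftrightarrow> \<not> (\<exists>x. \<forall>j. f x $ j < f xb $ j)"

definition std_simplex :: "(real^'m) set" where
  "std_simplex = {l. (\<Sum>j\<in>UNIV. l $ j) = 1 \<and> (\<forall>j. 0 \<le> l $ j)}"

definition comb_grad :: "(real^'n \<Rightarrow> real^'m) \<Rightarrow> real^'n \<Rightarrow> real^'m \<Rightarrow> real^'n" where
  "comb_grad f x l = (\<Sum>j\<in>UNIV. l $ j *\<^sub>R grad (\<lambda>y. f y $ j) x)"

definition pareto_critical :: "(real^'n \<Rightarrow> real^'m) \<Rightarrow> real^'n \<Rightarrow> bool" where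
  "pareto_critical f x \<longleftrightarrow> (\<exists>l\<in>std_simplex. comb_grad f x l = 0)"

definition omega_obj :: "(real^'n \<Rightarrow> real^'m) \<Rightarrow> real^'n \<Rightarrow> real^'m \<Rightarrow> real" where
  "omega_obj f x l = (norm (comb_grad f x l))\<^sup>2"

definition omega :: "(real^'n \<Rightarrow> real^'m) \<Rightarrow> real^'n \<Rightarrow> real" where
  "omega f x = (INF l\<in>std_simplex. omega_obj f x l)"

definition max_slope :: "(real^'n \<Rightarrow> real^'m) \<Rightarrow> real^'n \<Rightarrow> real^'n \<Rightarrow> real" where
  "max_slope f x d = Max (range (\<lambda>j. grad (\<lambda>y. f y $ j) x \<bullet> d))"

definition reg_slope :: "(real^'n \<Rightarrow> real^'m) \<Rightarrow> real^'n \<Rightarrow> real^'n \<Rightarrow> real" where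
  "reg_slope f x d = max_slope f x d + 1 / 2 * (norm d)\<^sup>2"

definition common_descent :: "(real^'n \<Rightarrow> real^'m) \<Rightarrow> real^'n \<Rightarrow> real^'n \<Rightarrow> bool" where
  "common_descent f x v \<longleftrightarrow>
     (\<exists>t0>0. \<forall>j. \<forall>t\<in>{0<..t0}. f (x + t *\<^sub>R v) $ j < f x $ j)"

lemma compact_std_simplex: "compact (std_simplex :: (real^'m) set)"
proof (rule compact_eq_bounded_closed[THEN iffD2, OF conjI])
  have "norm l \<le> 1" if "l \<in> std_simplex" for l :: "real^'m"
    using norm_le_l1_cart[of l] that by (simp add: std_simplex_def)
  then show "bounded (std_simplex :: (real^'m) set)"
    by (auto simp: bounded_iff)
  show "closed (std_simplex :: (real^'m) set)"
    unfolding std_simplex_def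
    by (intro closed_Collect_conj closed_Collect_all closed_Collect_eq closed_Collect_le
        continuous_intros)
qed

lemma std_simplex_nonempty: "(std_simplex :: (real^'m) set) \<noteq> {}"
proof -
  have "axis undefined 1 \<in> (std_simplex :: (real^'m) set)"
    by (simp add: std_simplex_def axis_def)
  then show ?thesis by blast
qed

lemma omega_attained: "\<exists>l. is_arg_min (omega_obj f x) (\<lambda>l. l \<in> std_simplex) l"
proof -
  have "continuous_on std_simplex (omega_obj f x)"
    unfolding omega_obj_def comb_grad_def by (intro continuous_intros)
  from continuous_attains_inf[OF compact_std_simplex std_simplex_nonempty this]
  show ?thesis by (auto simp: is_arg_min_linorder)
qed

lemma omega_eq:
  assumes "is_arg_min (omega_obj f x) (\<lambda>l. l \<in> std_simplex) l"
  shows "omega f x = omega_obj f x l"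
  unfolding omega_def
  using assms by (intro cInf_eq_minimum) (auto simp: is_arg_min_linorder)

lemma not_pareto_critical_iff: "\<not> pareto_critical f x \<longleftrightarrow> omega f x > 0"
proof -
  obtain l where l: "is_arg_min (omega_obj f x) (\<lambda>l. l \<in> std_simplex) l"
    using omega_attained by blast
  show ?thesis
  proof
    assume "\<not> pareto_critical f x"
    then show "omega f x > 0"
      using l omega_eq[OF l]
      by (auto simp: pareto_critical_def omega_obj_def is_arg_min_linorder)
  next
    assume pos: "omega f x > 0"
    show "\<not> pareto_critical f x"
    proof
      assume "pareto_critical f x"
      then obtain l' where "l' \<in> std_simplex" "comb_grad f x l' = 0"
        by (auto simp: pareto_critical_def)
      then have "omega_obj f x l \<le> 0"
        using l by (fastforce simp: omega_obj_def is_arg_min_linorder)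
      with pos omega_eq[OF l] show False by simp
    qed
  qed
qed

end

theory Submission
  imports Defs
begin

text \<open>
  The vector \<open>gk\<close> is the point of least norm in the convex hull of the gradients, so the variational
  inequality of the projection of 0 gives \<open>\<nabla>f\<^sub>j \<bullet> gk \<ge> \<bar>gk\<bar>\<^sup>2\<close> for every \<open>j\<close>. Conversely, a
  maximum dominates every convex combination, so \<open>max\<^sub>j \<nabla>f\<^sub>j \<bullet> d \<ge> gk \<bullet> d\<close> for every \<open>d\<close>, with
  equality on the ray spanned by \<open>- gk\<close>. Parts (a) and (b) then follow from Cauchy-Schwarz and from
  \<open>gk \<bullet> d + \<bar>d\<bar>\<^sup>2 / 2 = (\<bar>d + gk\<bar>\<^sup>2 - \<bar>gk\<bar>\<^sup>2) / 2\<close>.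
\<close>

lemma convex_std_simplex: "convex (std_simplex :: (real^'m) set)"
  by (rule convexI) (auto simp: std_simplex_def sum.distrib sum_distrib_left[symmetric])

lemma linear_comb_grad: "linear (comb_grad f x)"
  by (rule linearI)
    (simp_all add: comb_grad_def scaleR_add_left sum.distrib scaleR_sum_right)

lemma axis_in_std_simplex: "axis j 1 \<in> (std_simplex :: (real^'m) set)"
  by (simp add: std_simplex_def axis_def)

text \<open>Vertices of the simplex recover the single gradients; this places each gradient in the
  convex set whose least-norm point is studied.\<close>

lemma comb_grad_axis: "comb_grad f x (axis j 1) = grad (\<lambda>y. f y $ j) x"
proof -
  have "comb_grad f x (axis j 1) = (\<Sum>i\<in>UNIV. if i = j then grad (\<lambda>y. f y $ i) x else 0)"
    unfolding comb_grad_def by (rule sum.cong) (auto simp: axis_def)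
  then show ?thesis
    by simp
qed

lemma grad_inner_le_max_slope: "grad (\<lambda>y. f y $ j) x \<bullet> d \<le> max_slope f x d"
  unfolding max_slope_def by (intro Max_ge) auto

lemma max_slope_leI:
  assumes "\<And>j. grad (\<lambda>y. f y $ j) x \<bullet> d \<le> c"
  shows "max_slope f x d \<le> c"
  unfolding max_slope_def using assms by (subst Max_le_iff) auto

lemma comb_grad_inner_le_max_slope:
  assumes "l \<in> std_simplex"
  shows "comb_grad f x l \<bullet> d \<le> max_slope f x d"
proof -
  have "comb_grad f x l \<bullet> d = (\<Sum>j\<in>UNIV. l $ j * (grad (\<lambda>y. f y $ j) x \<bullet> d))"
    by (simp add: comb_grad_def inner_sum_left)
  also have "\<dots> \<le> (\<Sum>j\<in>UNIV. l $ j * max_slope f x d)"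
    using assms
    by (intro sum_mono mult_left_mono grad_inner_le_max_slope) (auto simp: std_simplex_def)
  also have "\<dots> = max_slope f x d"
    using assms by (simp add: std_simplex_def flip: sum_distrib_right)
  finally show ?thesis .
qed

text \<open>The image of the simplex under \<open>comb_grad f x\<close> is closed and convex, and an
  optimal \<open>l\<close> yields its point closest to 0. The obtuse-angle criterion for closest
  points, tested at the \<open>j\<close>-th gradient, is the claim.\<close>

lemma norm_sq_le_grad_inner_comb_grad:
  assumes "is_arg_min (omega_obj f x) (\<lambda>l. l \<in> std_simplex) l"
  shows "(norm (comb_grad f x l))\<^sup>2 \<le> grad (\<lambda>y. f y $ j) x \<bullet> comb_grad f x l"
proof -
  let ?S = "comb_grad f x ` std_simplex"
  have "continuous_on std_simplex (comb_grad f x)"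
    by (intro linear_continuous_on linear_comb_grad[THEN linear_conv_bounded_linear[THEN iffD1]])
  then have "closed ?S"
    by (intro compact_imp_closed compact_continuous_image compact_std_simplex)
  moreover have "convex ?S"
    by (intro convex_linear_image linear_comb_grad convex_std_simplex)
  moreover have "comb_grad f x l \<in> ?S"
    using assms by (auto simp: is_arg_min_def)
  moreover have "grad (\<lambda>y. f y $ j) x \<in> ?S"
    using axis_in_std_simplex comb_grad_axis by (metis imageI)
  moreover have "\<forall>z\<in>?S. dist 0 (comb_grad f x l) \<le> dist 0 z"
    using assms by (auto simp: is_arg_min_linorder omega_obj_def)
  ultimately have
    "(0 - comb_grad f x l) \<bullet> (grad (\<lambda>y. f y $ j) x - comb_grad f x l) \<le> 0"
    by (intro any_closest_point_dot)
  then show ?thesis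
    by (simp add: inner_diff_right power2_norm_eq_inner inner_commute)
qed

text \<open>The factor \<open>t\<close> serves both directions of interest: \<open>t = 1\<close>
  gives the negative least-norm vector, and the reciprocal of its norm gives the normalised one. The
  upper bound uses optimality of \<open>l\<close>, the lower one only that \<open>l\<close> is a
  convex weight.\<close>

lemma max_slope_min_norm_direction:
  assumes "is_arg_min (omega_obj f x) (\<lambda>l. l \<in> std_simplex) l" and "0 \<le> t"
  shows "max_slope f x (- (t *\<^sub>R comb_grad f x l)) = - (t * (norm (comb_grad f x l))\<^sup>2)"
proof (rule antisym)
  show "max_slope f x (- (t *\<^sub>R comb_grad f x l)) \<le> - (t * (norm (comb_grad f x l))\<^sup>2)"
    using norm_sq_le_grad_inner_comb_grad[OF assms(1)] assms(2)
    by (intro max_slope_leI) (simp add: mult_left_mono)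
  have "l \<in> std_simplex"
    using assms(1) by (simp add: is_arg_min_def)
  from comb_grad_inner_le_max_slope[OF this, of f x "- (t *\<^sub>R comb_grad f x l)"]
  show "- (t * (norm (comb_grad f x l))\<^sup>2) \<le> max_slope f x (- (t *\<^sub>R comb_grad f x l))"
    by (simp add: power2_norm_eq_inner)
qed

text \<open>Restricting to the ray from \<open>x\<close> along \<open>v\<close> reduces this to a
  real function of \<open>t\<close> with negative derivative at 0.\<close>

lemma descent_along_negative_slope:
  fixes \<phi> :: "'a::euclidean_space \<Rightarrow> real"
  assumes "\<phi> differentiable (at x)" and "grad \<phi> x \<bullet> v < 0"
  shows "\<exists>e>0. \<forall>t>0. t < e \<longrightarrow> \<phi> (x + t *\<^sub>R v) < \<phi> x"
proof -
  \<comment> \<open>The base point is written as the value of the ray at \<open>t = 0\<close>, so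
    that the chain rule unifies.\<close>
  have "(\<phi> has_derivative (\<lambda>h. h \<bullet> grad \<phi> x)) (at (x + 0 *\<^sub>R v))"
    using GDERIV_grad[OF assms(1)] by (simp add: gderiv_def)
  moreover have "((\<lambda>t. x + t *\<^sub>R v) has_derivative (\<lambda>t. t *\<^sub>R v)) (at 0)"
    by (auto intro!: derivative_eq_intros)
  ultimately have
    "((\<lambda>t. \<phi> (x + t *\<^sub>R v)) has_derivative (\<lambda>t. (t *\<^sub>R v) \<bullet> grad \<phi> x)) (at 0)"
    by (rule has_derivative_compose[rotated])
  then have "((\<lambda>t. \<phi> (x + t *\<^sub>R v)) has_real_derivative (grad \<phi> x \<bullet> v)) (at 0)"
    unfolding has_field_derivative_def
    by (rule has_derivative_eq_rhs) (auto simp: inner_commute)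
  from DERIV_neg_dec_right[OF this assms(2)] show ?thesis
    by auto
qed

text \<open>A negative maximum makes every component decrease on some initial interval; as there are
  finitely many components, a common interval exists.\<close>

lemma common_descentI:
  assumes "\<And>j. (\<lambda>y. f y $ j) differentiable (at x)" and "max_slope f x v < 0"
  shows "common_descent f x v"
proof -
  have "\<forall>j. \<exists>e>0. \<forall>t>0. t < e \<longrightarrow> f (x + t *\<^sub>R v) $ j < f x $ j"
    using assms(1) le_less_trans[OF grad_inner_le_max_slope assms(2)]
    by (intro allI descent_along_negative_slope)
  then obtain e where e: "\<And>j. e j > 0"
    "\<And>j t. 0 < t \<Longrightarrow> t < e j \<Longrightarrow> f (x + t *\<^sub>R v) $ j < f x $ j"
    by metis
  \<comment> \<open>Halving is needed because each \<open>e j\<close> is an excluded bound, while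
    \<open>t0\<close> itself must be an admissible step.\<close>
  define t0 where "t0 = Min (range e) / 2"
  have pos: "Min (range e) > 0"
    using e(1) by (subst Min_gr_iff) auto
  have "t0 < e j" for j
  proof -
    have "Min (range e) \<le> e j"
      by (intro Min_le) auto
    with pos show ?thesis
      unfolding t0_def by linarith
  qed
  then have "f (x + t *\<^sub>R v) $ j < f x $ j" if "t \<in> {0<..t0}" for j t
    using that by (intro e(2)) (auto intro: le_less_trans)
  moreover have "t0 > 0"
    using pos by (simp add: t0_def)
  ultimately show ?thesis
    unfolding common_descent_def by blast
qed

theorem lemma9:
  fixes f :: "real^'n \<Rightarrow> real^'m" and xk :: "real^'n" and lk :: "real^'m"
    and gk nk :: "real^'n"
  assumes smooth: "\<And>j. C1_lipschitz_grad (\<lambda>y. f y $ j)"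
    and weff: "\<exists>xb. weakly_efficient f xb"
    and ncrit: "\<not> pareto_critical f xk"
    and lk: "is_arg_min (omega_obj f xk) (\<lambda>l. l \<in> std_simplex) lk"
    and gk: "gk = comb_grad f xk lk"
    and nk: "nk = - ((1 / norm gk) *\<^sub>R gk)"
  shows "is_arg_min (max_slope f xk) (\<lambda>d. (norm d)\<^sup>2 \<le> 1) nk
     \<and> (is_arg_min (reg_slope f xk) (\<lambda>d. True) (- gk)
         \<and> (\<forall>d. is_arg_min (reg_slope f xk) (\<lambda>d. True) d \<longrightarrow> d = - gk)
         \<and> omega f xk = (norm gk)\<^sup>2
         \<and> (norm gk)\<^sup>2 = - 2 * reg_slope f xk (- gk))
     \<and> (common_descent f xk nk \<and> common_descent f xk (- gk))"
proof -
  have diff: "(\<lambda>y. f y $ j) differentiable (at xk)" for j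
    using smooth by (auto simp: C1_lipschitz_grad_def)
  have lk_in: "lk \<in> std_simplex"
    using lk by (simp add: is_arg_min_def)
  \<comment> \<open>If \<open>gk\<close> were 0, the weights \<open>lk\<close> would witness Pareto
    criticality.\<close>
  have gk_pos: "norm gk > 0"
    using ncrit lk_in by (auto simp: pareto_critical_def gk)
  have slope_ge: "gk \<bullet> d \<le> max_slope f xk d" for d
    unfolding gk by (rule comb_grad_inner_le_max_slope[OF lk_in])
  have slope_gk: "max_slope f xk (- gk) = - (norm gk)\<^sup>2"
    using max_slope_min_norm_direction[OF lk, of 1] by (simp add: gk)
  have slope_nk: "max_slope f xk nk = - norm gk"
    using max_slope_min_norm_direction[OF lk, of "1 / norm gk"] gk_pos
    by (simp add: nk power2_eq_square flip: gk)
  \<comment> \<open>Completing the square: the first term on the right measures the distance to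
    \<open>- gk\<close>, so this one bound yields both minimality and uniqueness in (b).\<close>
  have reg_ge: "reg_slope f xk d \<ge> (norm (d + gk))\<^sup>2 / 2 - (norm gk)\<^sup>2 / 2" for d
  proof -
    have "(norm (d + gk))\<^sup>2 = (norm d)\<^sup>2 + 2 * (gk \<bullet> d) + (norm gk)\<^sup>2"
      by (simp add: power2_norm_eq_inner inner_add_left inner_add_right inner_commute)
    then show ?thesis
      using slope_ge[of d] unfolding reg_slope_def by linarith
  qed
  have reg_gk: "reg_slope f xk (- gk) = - ((norm gk)\<^sup>2 / 2)"
    by (simp add: reg_slope_def slope_gk)
  have "is_arg_min (max_slope f xk) (\<lambda>d. (norm d)\<^sup>2 \<le> 1) nk"
    unfolding is_arg_min_linorder
  proof (intro conjI allI impI)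
    show "(norm nk)\<^sup>2 \<le> 1"
      using gk_pos by (simp add: nk)
    fix d :: "real^'n" assume "(norm d)\<^sup>2 \<le> 1"
    then have "norm d \<le> 1"
      by (simp add: abs_square_le_1)
    then have "norm gk * norm d \<le> norm gk"
      by (simp add: mult_left_le)
    then show "max_slope f xk nk \<le> max_slope f xk d"
      using slope_ge[of d] Cauchy_Schwarz_ineq2[of gk d] unfolding slope_nk by linarith
  qed
  moreover have "is_arg_min (reg_slope f xk) (\<lambda>d. True) (- gk)"
    unfolding is_arg_min_linorder
  proof (intro conjI allI impI TrueI)
    show "reg_slope f xk (- gk) \<le> reg_slope f xk d" for d
      using reg_ge[of d] zero_le_power2[of "norm (d + gk)"] unfolding reg_gk by linarith
  qed
  moreover have "d = - gk" if "is_arg_min (reg_slope f xk) (\<lambda>d. True) d" for d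
  proof -
    have "reg_slope f xk d \<le> reg_slope f xk (- gk)"
      using that by (simp add: is_arg_min_linorder)
    then have "(norm (d + gk))\<^sup>2 \<le> 0"
      using reg_ge[of d] unfolding reg_gk by linarith
    then show ?thesis
      by (simp add: eq_neg_iff_add_eq_0)
  qed
  moreover have "omega f xk = (norm gk)\<^sup>2"
    using omega_eq[OF lk] by (simp add: omega_obj_def gk)
  moreover have "(norm gk)\<^sup>2 = - 2 * reg_slope f xk (- gk)"
    by (simp add: reg_gk)
  moreover have "common_descent f xk nk" "common_descent f xk (- gk)"
    using gk_pos by (auto intro!: common_descentI diff simp: slope_nk slope_gk)
  ultimately show ?thesis
    by blast
qed

end
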